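(* Suppose $\mathcal{A}_i=\{0,1,\dots,|\mathcal{A}_i|-1\}$ and $\Omega_i=\{0,1,\dots,|\Omega_i|-1\}$ for all $i\in\{1,\dots,N\}$. If all penalty functions $\hat p_k(\boldsymbol{\alpha},\boldsymbol{\omega})$, $k\in\{0,1,\dots,K\}$, have the preferred action property, and if the components of the random event vector are mutually independent, i.e. $\pi(\boldsymbol{\omega})=\prod_{i=1}^N q_i(\omega_i)$ for all $\boldsymbol{\omega}\in\Omega$, where $q_i(\omega_i)=Pr[\omega_i(t)=\omega_i]$, then it suffices to restrict attention to strategy functions $g_i(\omega_i)$ that are non-decreasing in $\omega_i$. That is, if the linear program $$\text{Minimize } \sum_{m=1}^M\theta_m r_0^{(m)}\quad\text{subject to } \sum_{m=1}^M\theta_m r_k^{(m)}\le c_k\ \ \forall k\in\{1,\dots,K\},\quad \theta_m\ge 0\ \ \forall m\in\{1,\dots,M\},\quad \sum_{m=1}^M\theta_m=1$$ is feasible, then it has an optimal solution $(\theta_1,\dots,\theta_M)$ such that $\theta_m>0$ only for indices $m$ for which every component function $g_i^{(m)}:\Omega_i\to\mathcal{A}_i$, $i\in\{1,\dots,N\}$, of the pure strategy $\boldsymbol{g}^{(m)}$ is non-decreasing.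
   Context: Setting. There are $N$ users. $\Omega=\Omega_1\times\cdots\times\Omega_N$ and $\mathcal{A}=\mathcal{A}_1\times\cdots\times\mathcal{A}_N$ are products of finite nonempty sets. The random event vectors $\boldsymbol{\omega}(t)=(\omega_1(t),\dots,\omega_N(t))\in\Omega$ are i.i.d. over slots $t\in\{0,1,2,\dots\}$, with $\pi(\boldsymbol{\omega})=Pr[\boldsymbol{\omega}(t)=\boldsymbol{\omega}]$. $K$ is a non-negative integer, $\hat p_k:\mathcal{A}\times\Omega\to\mathbb{R}$ for $k\in\{0,\dots,K\}$ are penalty functions, and $c_1,\dots,c_K$ are real numbers. Pure strategies. A pure strategy is a function $\boldsymbol{g}(\boldsymbol{\omega})=(g_1(\omega_1),\dots,g_N(\omega_N))$ with strategy functions $g_i:\Omega_i\to\mathcal{A}_i$. The $M=\prod_{i=1}^N|\mathcal{A}_i|^{|\Omega_i|}$ pure strategies are enumerated $\boldsymbol{g}^{(1)},\dots,\boldsymbol{g}^{(M)}$, and $r_k^{(m)}=\sum_{\boldsymbol{\omega}\in\Omega}\pi(\boldsymbol{\omega})\hat p_k(\boldsymbol{g}^{(m)}(\boldsymbol{\omega}),\boldsymbol{\omega})$. Notation. $[\boldsymbol{\alpha}_{\overline{i}},\alpha_i]$ denotes the vector $\boldsymbol{\alpha}=(\alpha_1,\dots,\alpha_N)$, where $\boldsymbol{\alpha}_{\overline{i}}$ is the $(N-1)$-dimensional vector of components $\alpha_j$, $j\ne i$; similarly $[\boldsymbol{\omega}_{\overline{i}},\omega_i]$. $\mathcal{A}_{\overline{i}}$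 and $\Omega_{\overline{i}}$ are the sets of all such $\boldsymbol{\alpha}_{\overline{i}}$ and $\boldsymbol{\omega}_{\overline{i}}$. Preferred action property. A function $\hat p:\mathcal{A}\times\Omega\to\mathbb{R}$ has the preferred action property if for all $i\in\{1,\dots,N\}$, all $\boldsymbol{\alpha}_{\overline{i}}\in\mathcal{A}_{\overline{i}}$ and all $\boldsymbol{\omega}_{\overline{i}}\in\Omega_{\overline{i}}$, $$\hat p([\boldsymbol{\alpha}_{\overline{i}},\alpha],[\boldsymbol{\omega}_{\overline{i}},\omega])-\hat p([\boldsymbol{\alpha}_{\overline{i}},\beta],[\boldsymbol{\omega}_{\overline{i}},\omega])\ \ge\ \hat p([\boldsymbol{\alpha}_{\overline{i}},\alpha],[\boldsymbol{\omega}_{\overline{i}},\gamma])-\hat p([\boldsymbol{\alpha}_{\overline{i}},\beta],[\boldsymbol{\omega}_{\overline{i}},\gamma])$$ whenever $\alpha,\beta\in\mathcal{A}_i$ satisfy $\alpha>\beta$ and $\omega,\gamma\in\Omega_i$ satisfy $\omega<\gamma$. *)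

theory Defs
  imports "HOL-Probability.Probability"
begin

(* X_1 x ... x X_N.  Users are indexed by 1..N; a vector is an extensional function on
   {1..N}, so that equality of vectors is equality of functions. *)
definition vectors :: "nat \<Rightarrow> (nat \<Rightarrow> nat set) \<Rightarrow> (nat \<Rightarrow> nat) set" where
  "vectors N X = (\<Pi>\<^sub>E i\<in>{1..N}. X i)"

(* The partial vectors, with component i missing.  The vector [v, x] obtained by
   inserting x as component i into such a v is v(i := x). *)
definition vectors_except :: "nat \<Rightarrow> (nat \<Rightarrow> nat set) \<Rightarrow> nat \<Rightarrow> (nat \<Rightarrow> nat) set" where
  "vectors_except N X i = (\<Pi>\<^sub>E j\<in>{1..N} - {i}. X j)"

(* A pure strategy is represented by its tuple (g_1, ..., g_N) of strategy functions
   g_i : Ev i -> Act i; for nonempty event sets, distinct tuples induce distinct maps on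
   event vectors. *)
definition pure_strategies ::
    "nat \<Rightarrow> (nat \<Rightarrow> nat set) \<Rightarrow> (nat \<Rightarrow> nat set) \<Rightarrow> (nat \<Rightarrow> nat \<Rightarrow> nat) set" where
  "pure_strategies N Ev Act = (\<Pi>\<^sub>E i\<in>{1..N}. (\<Pi>\<^sub>E w\<in>Ev i. Act i))"

definition apply_strategy :: "nat \<Rightarrow> (nat \<Rightarrow> nat \<Rightarrow> nat) \<Rightarrow> (nat \<Rightarrow> nat) \<Rightarrow> (nat \<Rightarrow> nat)" where
  "apply_strategy N g \<omega> = (\<lambda>i\<in>{1..N}. g i (\<omega> i))"

definition expected_penalty ::
    "nat \<Rightarrow> (nat \<Rightarrow> nat set) \<Rightarrow> ((nat \<Rightarrow> nat) \<Rightarrow> real) \<Rightarrow>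
     ((nat \<Rightarrow> nat) \<Rightarrow> (nat \<Rightarrow> nat) \<Rightarrow> real) \<Rightarrow> (nat \<Rightarrow> nat \<Rightarrow> nat) \<Rightarrow> real" where
  "expected_penalty N Ev \<pi> p g =
     (\<Sum>\<omega>\<in>vectors N Ev. \<pi> \<omega> * p (apply_strategy N g \<omega>) \<omega>)"

definition preferred_action_property ::
    "nat \<Rightarrow> (nat \<Rightarrow> nat set) \<Rightarrow> (nat \<Rightarrow> nat set) \<Rightarrow>
     ((nat \<Rightarrow> nat) \<Rightarrow> (nat \<Rightarrow> nat) \<Rightarrow> real) \<Rightarrow> bool" where
  "preferred_action_property N Ev Act p \<longleftrightarrow>
     (\<forall>i\<in>{1..N}. \<forall>a\<in>vectors_except N Act i. \<forall>w\<in>vectors_except N Ev i.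
        \<forall>\<alpha>\<in>Act i. \<forall>\<beta>\<in>Act i. \<forall>\<omega>\<in>Ev i. \<forall>\<gamma>\<in>Ev i.
          \<alpha> > \<beta> \<longrightarrow> \<omega> < \<gamma> \<longrightarrow>
          p (a(i := \<alpha>)) (w(i := \<omega>)) - p (a(i := \<beta>)) (w(i := \<omega>))
            \<ge> p (a(i := \<alpha>)) (w(i := \<gamma>)) - p (a(i := \<beta>)) (w(i := \<gamma>)))"

(* In the linear program, r k m is the coefficient of the variable \<theta> m in the
   objective (k = 0) or in the k-th constraint (k = 1, ..., K). *)
definition lp_feasible ::
    "nat \<Rightarrow> nat \<Rightarrow> (nat \<Rightarrow> nat \<Rightarrow> real) \<Rightarrow> (nat \<Rightarrow> real) \<Rightarrow> (nat \<Rightarrow> real) \<Rightarrow> bool" where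
  "lp_feasible K M r c \<theta> \<longleftrightarrow>
     (\<forall>k\<in>{1..K}. (\<Sum>m=1..M. \<theta> m * r k m) \<le> c k) \<and>
     (\<forall>m\<in>{1..M}. \<theta> m \<ge> 0) \<and>
     (\<Sum>m=1..M. \<theta> m) = 1"

definition lp_optimal ::
    "nat \<Rightarrow> nat \<Rightarrow> (nat \<Rightarrow> nat \<Rightarrow> real) \<Rightarrow> (nat \<Rightarrow> real) \<Rightarrow> (nat \<Rightarrow> real) \<Rightarrow> bool" where
  "lp_optimal K M r c \<theta> \<longleftrightarrow>
     lp_feasible K M r c \<theta> \<and>
     (\<forall>\<theta>'. lp_feasible K M r c \<theta>' \<longrightarrow>
        (\<Sum>m=1..M. \<theta> m * r 0 m) \<le> (\<Sum>m=1..M. \<theta>' m * r 0 m))"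

end

theory Submission
  imports Defs
begin

text \<open>
  Suppose that some strategy function \<open>g i\<close> has an inversion: \<open>x < y\<close> but
  \<open>g i x > g i y\<close>, where both events have positive probability. Exchanging the two actions on
  equal amounts of probability mass, namely \<open>min (q i x) (q i y)\<close> of each event, changes every
  expected penalty by this mass times an average of differences that the preferred action property
  makes nonpositive. Independence is what makes this legitimate: the averaging over the other
  users' events uses the same weights whether user \<open>i\<close> sees \<open>x\<close> or \<open>y\<close>.
  Since only part of the mass of the likelier event is moved, the result is a mixture of two pure
  strategies (\<open>uncross_strategy\<close>), which a linear program over mixtures can absorb
  (\<open>lp_optimal_split_mass\<close>).

  A single exchange may create new inversions, so repeating it need not visibly terminate. Instead,
  \<open>alignment\<close> is the expected sum of the products of event and action. It is linear in the
  mixture and strictly increases under every exchange. Among the optimal mixtures there is one of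
  maximal expected alignment (\<open>lp_optimal_tie_break\<close>), and no strategy in its support can have
  an inversion between events of positive probability.

  Events of probability zero are invisible to both the penalties and the alignment. They are
  repaired afterwards: each strategy function in the support is replaced by its running maximum
  over the events of positive probability, which is monotone everywhere and has the same penalties
  (\<open>penalty_running_max\<close>, \<open>lp_optimal_transport\<close>).
\<close>

section \<open>Linear programs over the probability simplex\<close>

lemma lp_feasible_cong:
  assumes "\<And>m. m \<in> {1..M} \<Longrightarrow> \<theta> m = \<theta>' m"
  shows "lp_feasible K M r c \<theta> \<longleftrightarrow> lp_feasible K M r c \<theta>'"
proof -
  have "(\<Sum>m=1..M. \<theta> m * f m) = (\<Sum>m=1..M. \<theta>' m * f m)" for f :: "nat \<Rightarrow> real"
    using assms by (intro sum.cong) auto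
  moreover have "(\<Sum>m=1..M. \<theta> m) = (\<Sum>m=1..M. \<theta>' m)"
    using assms by (intro sum.cong) auto
  ultimately show ?thesis
    using assms by (simp add: lp_feasible_def)
qed

text \<open>
  The constraints say nothing about \<open>\<theta> m\<close> for \<open>m\<close> outside \<open>{1..M}\<close>, so the
  feasible set is not compact as it stands. Setting these coordinates to zero
  does not affect the program and leaves a closed subset of a product of compact intervals, on which the
  objective attains its minimum.
\<close>

lemma lp_optimal_exists:
  assumes "lp_feasible K M r c \<theta>\<^sub>0"
  shows "\<exists>\<theta>. lp_optimal K M r c \<theta>"
proof -
  define B where "B = (\<Pi>\<^sub>E m\<in>UNIV. if m \<in> {1..M} then {0..1::real} else {0})"
  define S where "S = B \<inter> {\<theta>. lp_feasible K M r c \<theta>}"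
  define trunc where "trunc \<theta> = (\<lambda>m. if m \<in> {1..M} then \<theta> m else 0)" for \<theta> :: "nat \<Rightarrow> real"
  have cont: "continuous_on UNIV (\<lambda>\<theta>::nat \<Rightarrow> real. \<Sum>m=1..M. \<theta> m * f m)" for f
    by (intro continuous_intros continuous_on_product_coordinates)
  have cont1: "continuous_on UNIV (\<lambda>\<theta>::nat \<Rightarrow> real. \<Sum>m=1..M. \<theta> m)"
    by (intro continuous_intros continuous_on_product_coordinates)
  have "compactin (product_topology (\<lambda>_. euclidean) UNIV) B"
    unfolding B_def by (subst compactin_PiE) auto
  then have "compact B"
    by (simp add: euclidean_product_topology)
  moreover have "closed {\<theta>. lp_feasible K M r c \<theta>}"
    unfolding lp_feasible_def Ball_def
    by (intro closed_Collect_conj closed_Collect_all closed_Collect_imp open_Collect_const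
        closed_Collect_le closed_Collect_eq cont cont1 continuous_on_const
        continuous_on_product_coordinates)
  ultimately have "compact S"
    unfolding S_def by (rule compact_Int_closed)
  have trunc_S: "trunc \<theta> \<in> S" if "lp_feasible K M r c \<theta>" for \<theta>
  proof -
    have "lp_feasible K M r c (trunc \<theta>)"
      using that lp_feasible_cong[of M \<theta> "trunc \<theta>"] by (simp add: trunc_def)
    moreover have "\<theta> m \<le> 1" if "m \<in> {1..M}" for m
      using \<open>lp_feasible K M r c \<theta>\<close> that member_le_sum[of m "{1..M}" \<theta>]
      by (auto simp: lp_feasible_def)
    ultimately show ?thesis
      using that by (auto simp: S_def B_def trunc_def lp_feasible_def)
  qed
  have "S \<noteq> {}"
    using trunc_S[OF assms] by blast
  with \<open>compact S\<close> obtain \<theta> where \<theta>: "\<theta> \<in> S"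
      "\<And>\<theta>'. \<theta>' \<in> S \<Longrightarrow> (\<Sum>m=1..M. \<theta> m * r 0 m) \<le> (\<Sum>m=1..M. \<theta>' m * r 0 m)"
    using continuous_attains_inf[of S "\<lambda>\<theta>. \<Sum>m=1..M. \<theta> m * r 0 m"]
      continuous_on_subset[OF cont] by blast
  have "(\<Sum>m=1..M. \<theta> m * r 0 m) \<le> (\<Sum>m=1..M. \<theta>' m * r 0 m)" if "lp_feasible K M r c \<theta>'" for \<theta>'
    using \<theta>(2)[OF trunc_S[OF that]] by (simp add: trunc_def)
  with \<theta>(1) show ?thesis
    by (auto simp: lp_optimal_def S_def)
qed

text \<open>
  The set of optimal solutions is itself the feasible set of a linear program: it suffices to add
  the constraint that the objective is at most the optimal value. Maximizing \<open>\<phi>\<close> over it is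
  therefore another instance of \<open>lp_optimal_exists\<close>.
\<close>

lemma lp_optimal_tie_break:
  fixes \<phi> :: "nat \<Rightarrow> real"
  assumes "lp_feasible K M r c \<theta>\<^sub>0"
  shows "\<exists>\<theta>. lp_optimal K M r c \<theta> \<and>
    (\<forall>\<theta>'. lp_optimal K M r c \<theta>' \<longrightarrow> (\<Sum>m=1..M. \<theta>' m * \<phi> m) \<le> (\<Sum>m=1..M. \<theta> m * \<phi> m))"
proof -
  obtain \<theta>\<^sub>1 where \<theta>\<^sub>1: "lp_optimal K M r c \<theta>\<^sub>1"
    using lp_optimal_exists[OF assms] by blast
  define r' where "r' k m = (if k = 0 then - \<phi> m else if k = Suc K then r 0 m else r k m)" for k m
  define c' where "c' = c(Suc K := \<Sum>m=1..M. \<theta>\<^sub>1 m * r 0 m)"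
  have feas: "lp_feasible (Suc K) M r' c' \<theta> \<longleftrightarrow>
      lp_feasible K M r c \<theta> \<and> (\<Sum>m=1..M. \<theta> m * r 0 m) \<le> (\<Sum>m=1..M. \<theta>\<^sub>1 m * r 0 m)" for \<theta>
  proof -
    have "(\<forall>k\<in>{1..Suc K}. (\<Sum>m=1..M. \<theta> m * r' k m) \<le> c' k) \<longleftrightarrow>
      (\<forall>k\<in>{1..K}. (\<Sum>m=1..M. \<theta> m * r k m) \<le> c k) \<and>
      (\<Sum>m=1..M. \<theta> m * r 0 m) \<le> (\<Sum>m=1..M. \<theta>\<^sub>1 m * r 0 m)"
      by (auto simp: atLeastAtMostSuc_conv r'_def c'_def)
    then show ?thesis
      by (auto simp: lp_feasible_def)
  qed
  have opt: "lp_feasible (Suc K) M r' c' \<theta> \<longleftrightarrow> lp_optimal K M r c \<theta>" for \<theta>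
    unfolding feas using \<theta>\<^sub>1 unfolding lp_optimal_def by (meson order_trans)
  obtain \<theta> where "lp_optimal (Suc K) M r' c' \<theta>"
    using lp_optimal_exists opt \<theta>\<^sub>1 by blast
  then show ?thesis
    unfolding lp_optimal_def[of "Suc K"] opt by (auto simp: r'_def sum_negf)
qed

text \<open>
  If a mixture of two columns is at least as cheap as a third column in every row, all weight of the
  third can be handed over to the two. The effect is given for an arbitrary linear
  functional \<open>\<phi>\<close>, so that it also applies to a tie-breaking functional that is not a
  row of the program. The three indices need not be distinct.
\<close>

lemma lp_optimal_split_mass:
  assumes opt: "lp_optimal K M r c \<theta>"
    and m: "m\<^sub>0 \<in> {1..M}" "m\<^sub>1 \<in> {1..M}" "m\<^sub>2 \<in> {1..M}"
    and l: "0 \<le> l" "l \<le> 1"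
    and le: "\<And>k. k \<in> {0..K} \<Longrightarrow> (1 - l) * r k m\<^sub>1 + l * r k m\<^sub>2 \<le> r k m\<^sub>0"
  obtains \<theta>' where "lp_optimal K M r c \<theta>'"
    and "\<And>\<phi>. (\<Sum>m=1..M. \<theta>' m * \<phi> m) =
      (\<Sum>m=1..M. \<theta> m * \<phi> m) + \<theta> m\<^sub>0 * ((1 - l) * \<phi> m\<^sub>1 + l * \<phi> m\<^sub>2 - \<phi> m\<^sub>0)"
proof -
  \<comment> \<open>Indicator functions rather than function updates, since the three indices may coincide.\<close>
  define \<theta>' where "\<theta>' m = \<theta> m + \<theta> m\<^sub>0 * ((1 - l) * of_bool (m = m\<^sub>1) + l * of_bool (m = m\<^sub>2)
    - of_bool (m = m\<^sub>0))" for m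
  have feas: "lp_feasible K M r c \<theta>"
    and min: "\<And>\<theta>'. lp_feasible K M r c \<theta>' \<Longrightarrow>
      (\<Sum>m=1..M. \<theta> m * r 0 m) \<le> (\<Sum>m=1..M. \<theta>' m * r 0 m)"
    using opt by (auto simp: lp_optimal_def)
  have nonneg: "0 \<le> \<theta> m" if "m \<in> {1..M}" for m
    using feas that by (auto simp: lp_feasible_def)
  have delta: "(\<Sum>m=1..M. of_bool (m = a) * \<phi> m) = \<phi> a" if "a \<in> {1..M}" for a and \<phi> :: "nat \<Rightarrow> real"
    using that sum.delta[of "{1..M}" a \<phi>] by (simp add: of_bool_def if_distrib if_distribR cong: if_cong)
  have lin: "(\<Sum>m=1..M. \<theta>' m * \<phi> m) =
      (\<Sum>m=1..M. \<theta> m * \<phi> m) + \<theta> m\<^sub>0 * ((1 - l) * \<phi> m\<^sub>1 + l * \<phi> m\<^sub>2 - \<phi> m\<^sub>0)" for \<phi>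
  proof -
    have "(\<Sum>m=1..M. \<theta>' m * \<phi> m) = (\<Sum>m=1..M. \<theta> m * \<phi> m) + \<theta> m\<^sub>0 *
        ((1 - l) * (\<Sum>m=1..M. of_bool (m = m\<^sub>1) * \<phi> m) + l * (\<Sum>m=1..M. of_bool (m = m\<^sub>2) * \<phi> m)
         - (\<Sum>m=1..M. of_bool (m = m\<^sub>0) * \<phi> m))"
      unfolding \<theta>'_def sum_distrib_left sum.distrib[symmetric] sum_subtractf[symmetric]
      by (intro sum.cong) (auto simp: algebra_simps)
    then show ?thesis
      using m by (simp only: delta)
  qed
  have drop: "(\<Sum>m=1..M. \<theta>' m * r k m) \<le> (\<Sum>m=1..M. \<theta> m * r k m)" if "k \<in> {0..K}" for k
    using lin[of "r k"] le[OF that] nonneg[OF m(1)] by (simp add: mult_nonneg_nonpos)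
  have "0 \<le> \<theta>' m" if "m \<in> {1..M}" for m
  proof -
    have "\<theta> m\<^sub>0 * of_bool (m = m\<^sub>0) \<le> \<theta> m"
      using nonneg[OF that] by auto
    moreover have "0 \<le> \<theta> m\<^sub>0 * ((1 - l) * of_bool (m = m\<^sub>1) + l * of_bool (m = m\<^sub>2))"
      using l nonneg[OF m(1)] by auto
    ultimately show ?thesis
      unfolding \<theta>'_def by (simp only: right_diff_distrib)
  qed
  moreover have "(\<Sum>m=1..M. \<theta>' m) = 1"
    using lin[of "\<lambda>_. 1"] feas by (simp add: lp_feasible_def)
  moreover have "(\<Sum>m=1..M. \<theta>' m * r k m) \<le> c k" if "k \<in> {1..K}" for k
  proof -
    have "(\<Sum>m=1..M. \<theta> m * r k m) \<le> c k"
      using feas that by (auto simp: lp_feasible_def)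
    then show ?thesis
      using drop[of k] that by auto
  qed
  ultimately have "lp_feasible K M r c \<theta>'"
    by (simp add: lp_feasible_def)
  moreover have "(\<Sum>m=1..M. \<theta>' m * r 0 m) \<le> (\<Sum>m=1..M. \<theta> m * r 0 m)"
    by (rule drop) simp
  ultimately have "lp_optimal K M r c \<theta>'"
    using min unfolding lp_optimal_def by (meson order_trans)
  then show thesis
    using lin by (rule that)
qed

text \<open>
  The new weights are the image of \<open>\<theta>\<close> under the relabelling \<open>f\<close> of columns.
\<close>

lemma lp_optimal_transport:
  assumes opt: "lp_optimal K M r c \<theta>"
    and f: "f ` {1..M} \<subseteq> {1..M}"
    and eq: "\<And>k m. k \<in> {0..K} \<Longrightarrow> m \<in> {1..M} \<Longrightarrow> 0 < \<theta> m \<Longrightarrow> r k (f m) = r k m"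
  obtains \<theta>' where "lp_optimal K M r c \<theta>'"
    and "\<And>m. m \<in> {1..M} \<Longrightarrow> 0 < \<theta>' m \<Longrightarrow> m \<in> f ` {1..M}"
proof -
  define \<theta>' where "\<theta>' m = (\<Sum>n | n \<in> {1..M} \<and> f n = m. \<theta> n)" for m
  have nonneg: "0 \<le> \<theta> m" if "m \<in> {1..M}" for m
    using opt that by (auto simp: lp_optimal_def lp_feasible_def)
  have push: "(\<Sum>m=1..M. \<theta>' m * \<phi> m) = (\<Sum>m=1..M. \<theta> m * \<phi> (f m))" for \<phi>
  proof -
    have "(\<Sum>m=1..M. \<theta>' m * \<phi> m) = (\<Sum>m=1..M. \<Sum>n | n \<in> {1..M} \<and> f n = m. \<theta> n * \<phi> (f n))"
      unfolding \<theta>'_def sum_distrib_right by (intro sum.cong) auto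
    also have "\<dots> = (\<Sum>m=1..M. \<theta> m * \<phi> (f m))"
      using f by (intro sum.group) auto
    finally show ?thesis .
  qed
  have same: "(\<Sum>m=1..M. \<theta>' m * r k m) = (\<Sum>m=1..M. \<theta> m * r k m)" if "k \<in> {0..K}" for k
    unfolding push
  proof (rule sum.cong)
    fix m assume m: "m \<in> {1..M}"
    show "\<theta> m * r k (f m) = \<theta> m * r k m"
      using eq[OF that m] nonneg[OF m] by (cases "\<theta> m = 0") auto
  qed simp
  have "0 \<le> \<theta>' m" for m
    unfolding \<theta>'_def using nonneg by (intro sum_nonneg) auto
  then have "lp_optimal K M r c \<theta>'"
    using opt same push[of "\<lambda>_. 1"] by (simp add: lp_optimal_def lp_feasible_def)
  moreover have "m \<in> f ` {1..M}" if "0 < \<theta>' m" for m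
  proof (rule ccontr)
    assume "m \<notin> f ` {1..M}"
    then have "{n \<in> {1..M}. f n = m} = {}" by auto
    then have "\<theta>' m = 0" by (simp only: \<theta>'_def sum.empty)
    with that show False by simp
  qed
  ultimately show thesis
    using that by blast
qed

section \<open>Uncrossing an inversion of a strategy function\<close>

text \<open>
  Let \<open>q x \<le> q y\<close>. Then \<open>x\<close> always gets the action of \<open>y\<close>, while \<open>y\<close> gets that of
  \<open>x\<close> only with probability \<open>q x / q y\<close>, so that both exchanged masses are \<open>q x\<close>. If
  \<open>q x > q y\<close> the roles are reversed. The mixture is found before \<open>h\<close> is given, so that the
  same one serves every penalty function, every choice of events and actions of the other users, and the alignment.
\<close>

lemma uncross_inversion:
  fixes q :: "nat \<Rightarrow> real" and f :: "nat \<Rightarrow> nat"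
  assumes fin: "finite X" and xy: "x \<in> X" "y \<in> X" "x \<noteq> y"
    and pos: "0 < q x" "0 < q y" and f: "f \<in> X \<rightarrow>\<^sub>E A"
  obtains f\<^sub>1 f\<^sub>2 l where "f\<^sub>1 \<in> X \<rightarrow>\<^sub>E A" "f\<^sub>2 \<in> X \<rightarrow>\<^sub>E A" "0 \<le> l" "l \<le> 1"
    and "\<And>h :: nat \<Rightarrow> nat \<Rightarrow> real.
      (1 - l) * (\<Sum>z\<in>X. q z * h z (f\<^sub>1 z)) + l * (\<Sum>z\<in>X. q z * h z (f\<^sub>2 z)) =
      (\<Sum>z\<in>X. q z * h z (f z)) - min (q x) (q y) * (h x (f x) - h x (f y) - (h y (f x) - h y (f y)))"
proof -
  have upd: "f'(z := a) \<in> X \<rightarrow>\<^sub>E A" if "f' \<in> X \<rightarrow>\<^sub>E A" "z \<in> X" "a \<in> A" for f' :: "nat \<Rightarrow> nat" and z a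
    using that by (auto simp: PiE_iff extensional_def)
  have sum_upd: "(\<Sum>z\<in>X. q z * h z ((f'(v := a)) z)) = (\<Sum>z\<in>X. q z * h z (f' z)) + q v * (h v a - h v (f' v))"
    if "v \<in> X" for f' v a and h :: "nat \<Rightarrow> nat \<Rightarrow> real"
  proof -
    have "(\<Sum>z\<in>X - {v}. q z * h z ((f'(v := a)) z)) = (\<Sum>z\<in>X - {v}. q z * h z (f' z))"
      by (intro sum.cong) auto
    then show ?thesis
      using that fin by (simp add: sum.remove[of X v] algebra_simps)
  qed
  have vals: "f x \<in> A" "f y \<in> A"
    using f xy by auto
  \<comment> \<open>The full exchange is one of the two components of the mixture in either case.\<close>
  define s where "s = f(x := f y, y := f x)"
  have s: "s \<in> X \<rightarrow>\<^sub>E A"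
    unfolding s_def using f xy vals by (intro upd)
  have sum_s: "(\<Sum>z\<in>X. q z * h z (s z)) = (\<Sum>z\<in>X. q z * h z (f z)) +
      q x * (h x (f y) - h x (f x)) + q y * (h y (f x) - h y (f y))" for h
    unfolding s_def using xy by (simp only: sum_upd) simp
  show thesis
  proof (cases "q x \<le> q y")
    case True
    show thesis
    proof (rule that[of "f(x := f y)" s "q x / q y"])
      fix h :: "nat \<Rightarrow> nat \<Rightarrow> real"
      show "(1 - q x / q y) * (\<Sum>z\<in>X. q z * h z ((f(x := f y)) z)) + q x / q y * (\<Sum>z\<in>X. q z * h z (s z)) =
        (\<Sum>z\<in>X. q z * h z (f z)) - min (q x) (q y) * (h x (f x) - h x (f y) - (h y (f x) - h y (f y)))"
        unfolding sum_s sum_upd[OF xy(1)] using True pos by (simp add: min_def field_simps)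
    qed (use True pos s f xy vals upd in auto)
  next
    case False
    show thesis
    proof (rule that[of "f(y := f x)" s "q y / q x"])
      fix h :: "nat \<Rightarrow> nat \<Rightarrow> real"
      show "(1 - q y / q x) * (\<Sum>z\<in>X. q z * h z ((f(y := f x)) z)) + q y / q x * (\<Sum>z\<in>X. q z * h z (s z)) =
        (\<Sum>z\<in>X. q z * h z (f z)) - min (q x) (q y) * (h x (f x) - h x (f y) - (h y (f x) - h y (f y)))"
        unfolding sum_s sum_upd[OF xy(2)] using False pos by (simp add: min_def field_simps)
    qed (use False pos s f xy vals upd in auto)
  qed
qed

section \<open>Strategies for independent events\<close>

text \<open>
  Action \<open>0\<close> has to be available because it is the value of a running maximum over no events.
\<close>

locale independent_events =
  fixes N :: nat and Ev Act :: "nat \<Rightarrow> nat set"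
    and \<pi> :: "(nat \<Rightarrow> nat) \<Rightarrow> real" and q :: "nat \<Rightarrow> nat \<Rightarrow> real"
  assumes finite_Ev: "i \<in> {1..N} \<Longrightarrow> finite (Ev i)"
    and zero_Act: "i \<in> {1..N} \<Longrightarrow> 0 \<in> Act i"
    and q_nonneg: "i \<in> {1..N} \<Longrightarrow> x \<in> Ev i \<Longrightarrow> 0 \<le> q i x"
    and product: "\<omega> \<in> vectors N Ev \<Longrightarrow> \<pi> \<omega> = (\<Prod>i=1..N. q i (\<omega> i))"
begin

abbreviation "penalty p g \<equiv> expected_penalty N Ev \<pi> p g"

abbreviation "strategies \<equiv> pure_strategies N Ev Act"

definition others :: "nat \<Rightarrow> (nat \<Rightarrow> nat \<Rightarrow> nat) \<Rightarrow> (nat \<Rightarrow> nat) \<Rightarrow> (nat \<Rightarrow> nat)" where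
  "others i g v = (\<lambda>j\<in>{1..N} - {i}. g j (v j))"

lemma strategies_fun_upd:
  assumes "g \<in> strategies" "i \<in> {1..N}" "f \<in> Ev i \<rightarrow>\<^sub>E Act i"
  shows "g(i := f) \<in> strategies"
  using assms by (auto simp: pure_strategies_def PiE_iff extensional_def)

text \<open>
  Averaging first over the event of user \<open>i\<close>, with all other events \<open>v\<close> fixed. By independence the
  weight of \<open>v\<close> does not depend on \<open>x\<close>, and the inner sum has the form treated in
  \<open>uncross_inversion\<close>.
\<close>

lemma penalty_conditional:
  assumes i: "i \<in> {1..N}"
  shows "penalty p g = (\<Sum>v\<in>vectors_except N Ev i. (\<Prod>j\<in>{1..N} - {i}. q j (v j)) *
    (\<Sum>x\<in>Ev i. q i x * p ((others i g v)(i := g i x)) (v(i := x))))"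
proof -
  have ins: "insert i ({1..N} - {i}) = {1..N}"
    using i by auto
  have img: "vectors N Ev = (\<lambda>(x, v). v(i := x)) ` (Ev i \<times> vectors_except N Ev i)"
    unfolding vectors_def vectors_except_def by (rule PiE_insert_eq[of i "{1..N} - {i}" Ev, unfolded ins])
  have inj: "inj_on (\<lambda>(x, v). v(i := x)) (Ev i \<times> vectors_except N Ev i)"
    unfolding vectors_except_def by (rule inj_combinator) simp
  have summand: "\<pi> (v(i := x)) * p (apply_strategy N g (v(i := x))) (v(i := x)) =
      (\<Prod>j\<in>{1..N} - {i}. q j (v j)) * (q i x * p ((others i g v)(i := g i x)) (v(i := x)))"
    if "x \<in> Ev i" "v \<in> vectors_except N Ev i" for x v
  proof -
    have "v(i := x) \<in> vectors N Ev"
      using that img by auto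
    then have "\<pi> (v(i := x)) = (\<Prod>j=1..N. q j ((v(i := x)) j))"
      by (rule product)
    also have "\<dots> = q i x * (\<Prod>j\<in>{1..N} - {i}. q j ((v(i := x)) j))"
      using i by (simp add: prod.remove)
    also have "(\<Prod>j\<in>{1..N} - {i}. q j ((v(i := x)) j)) = (\<Prod>j\<in>{1..N} - {i}. q j (v j))"
      by (intro prod.cong) auto
    finally have "\<pi> (v(i := x)) = q i x * (\<Prod>j\<in>{1..N} - {i}. q j (v j))" .
    moreover have "apply_strategy N g (v(i := x)) = (others i g v)(i := g i x)"
      using i by (auto simp: apply_strategy_def others_def)
    ultimately show ?thesis
      by simp
  qed
  have "penalty p g = (\<Sum>(x, v)\<in>Ev i \<times> vectors_except N Ev i.
      \<pi> (v(i := x)) * p (apply_strategy N g (v(i := x))) (v(i := x)))"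
    unfolding expected_penalty_def img sum.reindex[OF inj] by (simp add: case_prod_unfold)
  also have "\<dots> = (\<Sum>(x, v)\<in>Ev i \<times> vectors_except N Ev i.
      (\<Prod>j\<in>{1..N} - {i}. q j (v j)) * (q i x * p ((others i g v)(i := g i x)) (v(i := x))))"
    by (intro sum.cong) (auto simp: summand)
  also have "\<dots> = (\<Sum>x\<in>Ev i. \<Sum>v\<in>vectors_except N Ev i.
      (\<Prod>j\<in>{1..N} - {i}. q j (v j)) * (q i x * p ((others i g v)(i := g i x)) (v(i := x))))"
    by (simp add: sum.cartesian_product)
  also have "\<dots> = (\<Sum>v\<in>vectors_except N Ev i. \<Sum>x\<in>Ev i.
      (\<Prod>j\<in>{1..N} - {i}. q j (v j)) * (q i x * p ((others i g v)(i := g i x)) (v(i := x))))"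
    by (rule sum.swap)
  finally show ?thesis
    by (simp add: sum_distrib_left)
qed

text \<open>
  The exchanges leave the distribution of each user's actions unchanged; given that distribution,
  the expected product of event and action is largest when larger actions go with larger events.
\<close>

definition alignment :: "(nat \<Rightarrow> nat \<Rightarrow> nat) \<Rightarrow> real" where
  "alignment g = (\<Sum>i=1..N. \<Sum>x\<in>Ev i. q i x * (real x * real (g i x)))"

text \<open>
  Both claims are instances of the same identity. For a penalty, \<open>h\<close> is the penalty with the other
  users' events and actions fixed, and the bracket in the identity is nonnegative by the
  preferred action property. For the alignment, \<open>h z a = z * a\<close>, and the bracket is the negative
  number \<open>(x - y) * (g i x - g i y)\<close>; strictness also needs both probabilities to be positive.
\<close>

lemma uncross_strategy:
  assumes g: "g \<in> strategies" and i: "i \<in> {1..N}"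
    and xy: "x \<in> Ev i" "y \<in> Ev i" "x < y" "g i y < g i x"
    and pos: "0 < q i x" "0 < q i y"
  obtains g\<^sub>1 g\<^sub>2 l where "g\<^sub>1 \<in> strategies" "g\<^sub>2 \<in> strategies" "0 \<le> l" "l \<le> 1"
    and "\<And>p. preferred_action_property N Ev Act p \<Longrightarrow>
      (1 - l) * penalty p g\<^sub>1 + l * penalty p g\<^sub>2 \<le> penalty p g"
    and "alignment g < (1 - l) * alignment g\<^sub>1 + l * alignment g\<^sub>2"
proof -
  have gi: "g i \<in> Ev i \<rightarrow>\<^sub>E Act i"
    using g i by (auto simp: pure_strategies_def)
  have "x \<noteq> y"
    using xy by simp
  from uncross_inversion[OF finite_Ev[OF i] xy(1,2) this, of "q i", OF pos gi]
  obtain f\<^sub>1 f\<^sub>2 l where f: "f\<^sub>1 \<in> Ev i \<rightarrow>\<^sub>E Act i" "f\<^sub>2 \<in> Ev i \<rightarrow>\<^sub>E Act i" and l: "0 \<le> l" "l \<le> 1"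
    and mix: "\<And>h :: nat \<Rightarrow> nat \<Rightarrow> real.
      (1 - l) * (\<Sum>z\<in>Ev i. q i z * h z (f\<^sub>1 z)) + l * (\<Sum>z\<in>Ev i. q i z * h z (f\<^sub>2 z)) =
      (\<Sum>z\<in>Ev i. q i z * h z (g i z)) - min (q i x) (q i y) *
        (h x (g i x) - h x (g i y) - (h y (g i x) - h y (g i y)))"
    by blast
  have min_pos: "0 < min (q i x) (q i y)"
    using pos by simp
  have "(1 - l) * penalty p (g(i := f\<^sub>1)) + l * penalty p (g(i := f\<^sub>2)) \<le> penalty p g"
    if pap: "preferred_action_property N Ev Act p" for p
  proof -
    define Q where "Q v = (\<Prod>j\<in>{1..N} - {i}. q j (v j))" for v
    define h where "h v z a = p ((others i g v)(i := a)) (v(i := z))" for v z a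
    have pen: "penalty p (g(i := f)) =
        (\<Sum>v\<in>vectors_except N Ev i. Q v * (\<Sum>z\<in>Ev i. q i z * h v z (f z)))" for f
    proof -
      have "others i (g(i := f)) = others i g"
        by (auto simp: others_def fun_eq_iff)
      then show ?thesis
        using penalty_conditional[OF i, of p "g(i := f)"] by (simp add: Q_def h_def)
    qed
    have "Q v * ((1 - l) * (\<Sum>z\<in>Ev i. q i z * h v z (f\<^sub>1 z)) + l * (\<Sum>z\<in>Ev i. q i z * h v z (f\<^sub>2 z)))
        \<le> Q v * (\<Sum>z\<in>Ev i. q i z * h v z (g i z))" if v: "v \<in> vectors_except N Ev i" for v
    proof -
      have "others i g v \<in> vectors_except N Act i"
        using g v by (auto simp: pure_strategies_def vectors_except_def others_def PiE_iff)
      then have "h v x (g i x) - h v x (g i y) \<ge> h v y (g i x) - h v y (g i y)"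
        using pap i xy v gi unfolding preferred_action_property_def h_def by (auto simp: PiE_iff)
      then have "0 \<le> min (q i x) (q i y) *
          (h v x (g i x) - h v x (g i y) - (h v y (g i x) - h v y (g i y)))"
        using min_pos by (intro mult_nonneg_nonneg) auto
      moreover have "0 \<le> Q v"
        unfolding Q_def
      proof (rule prod_nonneg)
        fix j assume "j \<in> {1..N} - {i}"
        then show "0 \<le> q j (v j)"
          using v q_nonneg[of j "v j"] by (auto simp: vectors_except_def PiE_iff)
      qed
      ultimately show ?thesis
        unfolding mix by (intro mult_left_mono) auto
    qed
    then have "(\<Sum>v\<in>vectors_except N Ev i. Q v *
          ((1 - l) * (\<Sum>z\<in>Ev i. q i z * h v z (f\<^sub>1 z)) + l * (\<Sum>z\<in>Ev i. q i z * h v z (f\<^sub>2 z))))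
        \<le> (\<Sum>v\<in>vectors_except N Ev i. Q v * (\<Sum>z\<in>Ev i. q i z * h v z (g i z)))"
      by (rule sum_mono)
    moreover have "(1 - l) * penalty p (g(i := f\<^sub>1)) + l * penalty p (g(i := f\<^sub>2)) =
        (\<Sum>v\<in>vectors_except N Ev i. Q v *
          ((1 - l) * (\<Sum>z\<in>Ev i. q i z * h v z (f\<^sub>1 z)) + l * (\<Sum>z\<in>Ev i. q i z * h v z (f\<^sub>2 z))))"
      by (simp add: pen sum_distrib_left sum.distrib distrib_left mult_ac)
    moreover have "penalty p g = (\<Sum>v\<in>vectors_except N Ev i. Q v * (\<Sum>z\<in>Ev i. q i z * h v z (g i z)))"
      using pen[of "g i"] by simp
    ultimately show ?thesis
      by simp
  qed
  moreover have "alignment g < (1 - l) * alignment (g(i := f\<^sub>1)) + l * alignment (g(i := f\<^sub>2))"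
  proof -
    define R where "R = (\<Sum>j\<in>{1..N} - {i}. \<Sum>z\<in>Ev j. q j z * (real z * real (g j z)))"
    have al: "alignment (g(i := f)) = (\<Sum>z\<in>Ev i. q i z * (real z * real (f z))) + R" for f
    proof -
      have "(\<Sum>j\<in>{1..N} - {i}. \<Sum>z\<in>Ev j. q j z * (real z * real ((g(i := f)) j z))) = R"
        unfolding R_def by (intro sum.cong) auto
      then show ?thesis
        using i by (simp add: alignment_def sum.remove)
    qed
    have "0 < (real y - real x) * (real (g i x) - real (g i y))"
      using xy by simp
    then have "0 < min (q i x) (q i y) * ((real y - real x) * (real (g i x) - real (g i y)))"
      using min_pos by (rule mult_pos_pos[rotated])
    then have "alignment (g(i := g i)) < (1 - l) * alignment (g(i := f\<^sub>1)) + l * alignment (g(i := f\<^sub>2))"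
      unfolding al using mix[of "\<lambda>z a. real z * real a"] by (simp add: algebra_simps)
    then show ?thesis
      by simp
  qed
  ultimately show thesis
    using that[of "g(i := f\<^sub>1)" "g(i := f\<^sub>2)" l] strategies_fun_upd[OF g i] f l by blast
qed

text \<open>
  The maximum runs only over events of positive probability, so that an arbitrary choice of action on
  a null event cannot propagate to later events of positive probability.
\<close>

definition running_max :: "(nat \<Rightarrow> nat \<Rightarrow> nat) \<Rightarrow> (nat \<Rightarrow> nat \<Rightarrow> nat)" where
  "running_max g = (\<lambda>i\<in>{1..N}. \<lambda>x\<in>Ev i. Max (insert 0 (g i ` {z \<in> Ev i. z \<le> x \<and> 0 < q i z})))"

lemma running_max_strategies:
  assumes "g \<in> strategies"
  shows "running_max g \<in> strategies"
proof -
  have "Max (insert 0 (g i ` {z \<in> Ev i. z \<le> x \<and> 0 < q i z})) \<in> Act i" if "i \<in> {1..N}" for i x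
  proof -
    have "Max (insert 0 (g i ` {z \<in> Ev i. z \<le> x \<and> 0 < q i z})) \<in>
        insert 0 (g i ` {z \<in> Ev i. z \<le> x \<and> 0 < q i z})"
      using finite_Ev[OF that] by (intro Max_in) auto
    moreover have "g i z \<in> Act i" if "z \<in> Ev i" for z
      using assms \<open>i \<in> {1..N}\<close> that by (auto simp: pure_strategies_def PiE_iff)
    ultimately show ?thesis
      using zero_Act[OF that] by auto
  qed
  then show ?thesis
    by (auto simp: pure_strategies_def running_max_def)
qed

lemma mono_on_running_max:
  assumes "i \<in> {1..N}"
  shows "mono_on (Ev i) (running_max g i)"
proof (rule mono_onI)
  fix x y assume "x \<in> Ev i" "y \<in> Ev i" "x \<le> y"
  then show "running_max g i x \<le> running_max g i y"
    using assms finite_Ev[OF assms] by (auto simp: running_max_def intro!: Max_mono)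
qed

text \<open>
  An event vector of positive probability has, by independence, only components of positive
  probability. On those, a monotone function agrees with its running maximum.
\<close>

lemma penalty_running_max:
  assumes mono: "\<And>i. i \<in> {1..N} \<Longrightarrow> mono_on {x \<in> Ev i. 0 < q i x} (g i)"
  shows "penalty p (running_max g) = penalty p g"
  unfolding expected_penalty_def
proof (rule sum.cong)
  fix \<omega> assume \<omega>: "\<omega> \<in> vectors N Ev"
  show "\<pi> \<omega> * p (apply_strategy N (running_max g) \<omega>) \<omega> = \<pi> \<omega> * p (apply_strategy N g \<omega>) \<omega>"
  proof (cases "\<pi> \<omega> = 0")
    case False
    have "running_max g i (\<omega> i) = g i (\<omega> i)" if i: "i \<in> {1..N}" for i
    proof -
      have w: "\<omega> i \<in> Ev i"
        using \<omega> i by (auto simp: vectors_def)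
      have "q i (\<omega> i) \<noteq> 0"
        using False product[OF \<omega>] i by auto
      with q_nonneg[OF i w] have "0 < q i (\<omega> i)"
        by simp
      then have "Max (insert 0 (g i ` {z \<in> Ev i. z \<le> \<omega> i \<and> 0 < q i z})) = g i (\<omega> i)"
        using finite_Ev[OF i] w mono_onD[OF mono[OF i]] by (intro Max_eqI) auto
      then show ?thesis
        using i w by (simp add: running_max_def)
    qed
    then have "apply_strategy N (running_max g) \<omega> = apply_strategy N g \<omega>"
      by (auto simp: apply_strategy_def)
    then show ?thesis
      by simp
  qed simp
qed simp

end

theorem theorem2:
  fixes N K M :: nat
    and Ev Act :: "nat \<Rightarrow> nat set"
    and P :: "'s measure"
    and W :: "nat \<Rightarrow> 's \<Rightarrow> (nat \<Rightarrow> nat)"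
    and \<pi> :: "(nat \<Rightarrow> nat) \<Rightarrow> real"
    and q :: "nat \<Rightarrow> nat \<Rightarrow> real"
    and p :: "nat \<Rightarrow> (nat \<Rightarrow> nat) \<Rightarrow> (nat \<Rightarrow> nat) \<Rightarrow> real"
    and c :: "nat \<Rightarrow> real"
    and G :: "nat \<Rightarrow> (nat \<Rightarrow> nat \<Rightarrow> nat)"
    and r :: "nat \<Rightarrow> nat \<Rightarrow> real"
  assumes Act_finite: "\<And>i. i \<in> {1..N} \<Longrightarrow> finite (Act i) \<and> Act i \<noteq> {}"
    and Ev_finite: "\<And>i. i \<in> {1..N} \<Longrightarrow> finite (Ev i) \<and> Ev i \<noteq> {}"
    and Act_eq: "\<And>i. i \<in> {1..N} \<Longrightarrow> Act i = {0..<card (Act i)}"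
    and Ev_eq: "\<And>i. i \<in> {1..N} \<Longrightarrow> Ev i = {0..<card (Ev i)}"
    and prob: "prob_space P"
    and indep_slots: "prob_space.indep_vars P (\<lambda>t. count_space (vectors N Ev)) W UNIV"
    and \<pi>_eq: "\<And>t \<omega>. \<omega> \<in> vectors N Ev \<Longrightarrow> \<pi> \<omega> = measure P {s \<in> space P. W t s = \<omega>}"
    and q_eq: "\<And>t i x. i \<in> {1..N} \<Longrightarrow> x \<in> Ev i \<Longrightarrow> q i x = measure P {s \<in> space P. W t s i = x}"
    and indep_components: "\<And>\<omega>. \<omega> \<in> vectors N Ev \<Longrightarrow> \<pi> \<omega> = (\<Prod>i=1..N. q i (\<omega> i))"
    and preferred: "\<And>k. k \<in> {0..K} \<Longrightarrow> preferred_action_property N Ev Act (p k)"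
    and M_eq: "M = (\<Prod>i=1..N. card (Act i) ^ card (Ev i))"
    and enum: "bij_betw G {1..M} (pure_strategies N Ev Act)"
    and r_eq: "\<And>k m. k \<in> {0..K} \<Longrightarrow> m \<in> {1..M} \<Longrightarrow> r k m = expected_penalty N Ev \<pi> (p k) (G m)"
    and feasible: "\<exists>\<theta>. lp_feasible K M r c \<theta>"
  shows "\<exists>\<theta>. lp_optimal K M r c \<theta> \<and>
           (\<forall>m\<in>{1..M}. \<theta> m > 0 \<longrightarrow> (\<forall>i\<in>{1..N}. mono_on (Ev i) (G m i)))"
proof -
  interpret independent_events N Ev Act \<pi> q
  proof
    fix i assume i: "i \<in> {1..N}"
    show "finite (Ev i)"
      using Ev_finite[OF i] by blast
    show "0 \<in> Act i"
      using Act_finite[OF i] Act_eq[OF i] by (metis atLeastLessThan_iff card_gt_0_iff zero_le)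
    show "0 \<le> q i x" if "x \<in> Ev i" for x
      using q_eq[OF i that, of 0] by simp
  qed (rule indep_components)
  define index where "index = the_inv_into {1..M} G"
  have index: "index g \<in> {1..M}" "G (index g) = g" if "g \<in> pure_strategies N Ev Act" for g
    using that enum the_inv_into_into[of G "{1..M}" g "{1..M}"] f_the_inv_into_f[of G "{1..M}" g]
    by (auto simp: index_def bij_betw_def)
  have G: "G m \<in> pure_strategies N Ev Act" if "m \<in> {1..M}" for m
    using enum that by (auto simp: bij_betw_def)
  have r_index: "r k (index g) = expected_penalty N Ev \<pi> (p k) g"
    if "k \<in> {0..K}" "g \<in> pure_strategies N Ev Act" for k g
    using r_eq[OF that(1) index(1)[OF that(2)]] index(2)[OF that(2)] by simp
  \<comment> \<open>Maximal alignment among the optimal mixtures leaves no room for a further exchange.\<close>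
  obtain \<theta> where opt: "lp_optimal K M r c \<theta>"
    and tie: "\<And>\<theta>'. lp_optimal K M r c \<theta>' \<Longrightarrow>
      (\<Sum>m=1..M. \<theta>' m * alignment (G m)) \<le> (\<Sum>m=1..M. \<theta> m * alignment (G m))"
    using feasible lp_optimal_tie_break[of K M r c _ "\<lambda>m. alignment (G m)"] by blast
  have mono: "mono_on {x \<in> Ev i. 0 < q i x} (G m i)"
    if m: "m \<in> {1..M}" "0 < \<theta> m" and i: "i \<in> {1..N}" for m i
  proof (rule ccontr)
    assume "\<not> mono_on {x \<in> Ev i. 0 < q i x} (G m i)"
    then obtain x y where xy: "x \<in> Ev i" "y \<in> Ev i" "0 < q i x" "0 < q i y" "x \<le> y"
        "G m i y < G m i x"
      by (auto simp: mono_on_def not_le)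
    moreover have "x < y"
      using xy by (cases "x = y") auto
    ultimately obtain g\<^sub>1 g\<^sub>2 l where g: "g\<^sub>1 \<in> pure_strategies N Ev Act"
        "g\<^sub>2 \<in> pure_strategies N Ev Act" and l: "0 \<le> l" "l \<le> 1"
      and cheaper: "\<And>p. preferred_action_property N Ev Act p \<Longrightarrow>
        (1 - l) * expected_penalty N Ev \<pi> p g\<^sub>1 + l * expected_penalty N Ev \<pi> p g\<^sub>2
          \<le> expected_penalty N Ev \<pi> p (G m)"
      and aligned: "alignment (G m) < (1 - l) * alignment g\<^sub>1 + l * alignment g\<^sub>2"
      using uncross_strategy[OF G[OF m(1)] i] by metis
    have "(1 - l) * r k (index g\<^sub>1) + l * r k (index g\<^sub>2) \<le> r k m" if "k \<in> {0..K}" for k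
      using cheaper[OF preferred[OF that]] by (simp only: r_index[OF that] g r_eq[OF that m(1)])
    from lp_optimal_split_mass[OF opt m(1) index(1)[OF g(1)] index(1)[OF g(2)] l this]
    obtain \<theta>' where "lp_optimal K M r c \<theta>'"
      and "\<And>\<phi>. (\<Sum>m=1..M. \<theta>' m * \<phi> m) = (\<Sum>m=1..M. \<theta> m * \<phi> m) +
        \<theta> m * ((1 - l) * \<phi> (index g\<^sub>1) + l * \<phi> (index g\<^sub>2) - \<phi> m)"
      by blast
    then have "\<theta> m * ((1 - l) * alignment g\<^sub>1 + l * alignment g\<^sub>2 - alignment (G m)) \<le> 0"
      using tie[of \<theta>'] index(2)[OF g(1)] index(2)[OF g(2)] by simp
    moreover have "0 < \<theta> m * ((1 - l) * alignment g\<^sub>1 + l * alignment g\<^sub>2 - alignment (G m))"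
      using m(2) aligned by simp
    ultimately show False
      by simp
  qed
  \<comment> \<open>Monotonicity is extended from the events of positive probability to all events.\<close>
  define f where "f m = index (running_max (G m))" for m
  have G_f: "f m \<in> {1..M}" "G (f m) = running_max (G m)" if "m \<in> {1..M}" for m
    using index running_max_strategies[OF G[OF that]] by (auto simp: f_def)
  have "r k (f m) = r k m" if "k \<in> {0..K}" "m \<in> {1..M}" "0 < \<theta> m" for k m
    using penalty_running_max[OF mono[OF that(2,3)]] r_eq[OF that(1)] G_f[OF that(2)] that(2)
    by simp
  with opt obtain \<theta>' where "lp_optimal K M r c \<theta>'"
    and supp: "\<And>m. m \<in> {1..M} \<Longrightarrow> 0 < \<theta>' m \<Longrightarrow> m \<in> f ` {1..M}"
    using lp_optimal_transport[of K M r c \<theta> f] G_f(1) by (metis image_subsetI)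
  moreover have "mono_on (Ev i) (G m i)" if "m \<in> {1..M}" "0 < \<theta>' m" "i \<in> {1..N}" for m i
    using supp[OF that(1,2)] G_f(2) mono_on_running_max[OF that(3)] by auto
  ultimately show ?thesis
    by blast
qed

end
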